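(* Let $R=\mathbb Z[u_{s,i}^{\pm1},u_{t,j}^{\pm1},u_{u,l}^{\pm1}]_{1\le i,j,l\le 2}$ and let $H_{G_{13}}$ be the associative unital $R$-algebra $$H_{G_{13}}=\Big\langle s,t,u\ \Big|\ ustu=tust,\ stust=ustus,\ \prod_{i=1}^2(s-u_{s,i})=\prod_{j=1}^2(t-u_{t,j})=\prod_{l=1}^2(u-u_{u,l})=0\Big\rangle .$$ Let $u_1,u_2,u_3$ be the $R$-subalgebras generated by $s$, $t$, $u$ respectively, let $z=(stu)^3$, and let $$U=\sum_{k=0}^3z^k\big(u_1u_2u_1u_2+u_1u_2u_3u_2+u_2u_3u_1u_2+u_2u_1u_3u_2+u_3u_2u_1u_2\big).$$ Then $H_{G_{13}}=U$.
   Context: For subsets $X,Y$ of an $R$-algebra, $XY$ denotes the $R$-submodule spanned by the products $xy$. *)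

theory Defs
  imports Complex_Main "HOL-Library.Poly_Mapping" "HOL-Library.Set_Algebras"
begin

datatype gen = Gs | Gt | Gu
datatype idx = I1 | I2

text \<open>
  The Laurent polynomial ring over the integers in the six variables
  \<open>u_{g,i}\<close>: it is the monoid ring of the free abelian group on the variables, i.e.
  finitely supported integer combinations of monomials with integer exponents.
\<close>

type_synonym laurent = "((gen \<times> idx) \<Rightarrow>\<^sub>0 int) \<Rightarrow>\<^sub>0 int"

definition par :: "gen \<Rightarrow> idx \<Rightarrow> laurent"
  where "par g i = Poly_Mapping.single (Poly_Mapping.single (g, i) 1) 1"

lemma par_dvd_1: "par g i dvd 1"
proof
  show "1 = par g i * Poly_Mapping.single (Poly_Mapping.single (g, i) (- 1)) 1"
    by (simp add: par_def mult_single single_add[symmetric])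
qed

text \<open>
  Words form a monoid under concatenation. It is written additively because the
  convolution product of \<^type>\<open>poly_mapping\<close> expects an additive monoid of exponents.
\<close>

datatype word = Word (letters: "gen list")

instantiation word :: monoid_add
begin

definition zero_word :: word where "0 = Word []"
definition plus_word :: "word \<Rightarrow> word \<Rightarrow> word" where "v + w = Word (letters v @ letters w)"

instance
  by standard (simp_all add: zero_word_def plus_word_def)

end

type_synonym free_alg = "word \<Rightarrow>\<^sub>0 laurent"

definition const :: "laurent \<Rightarrow> free_alg"
  where "const c = Poly_Mapping.single 0 c"

definition var :: "gen \<Rightarrow> free_alg"
  where "var g = Poly_Mapping.single (Word [g]) 1"

lemma const_0: "const 0 = 0"
  by (simp add: const_def)

lemma const_1: "const 1 = 1"
  by (simp add: const_def)

lemma const_add: "const (c + d) = const c + const d"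
  by (simp add: const_def single_add)

lemma const_mult: "const (c * d) = const c * const d"
  by (simp add: const_def mult_single)

lemma poly_mapping_eq_sum: "(p :: 'k \<Rightarrow>\<^sub>0 'b::comm_monoid_add) = (\<Sum>k\<in>Poly_Mapping.keys p. Poly_Mapping.single k (Poly_Mapping.lookup p k))"
proof (rule poly_mapping_eqI)
  fix k
  have "Poly_Mapping.lookup (\<Sum>k\<in>Poly_Mapping.keys p. Poly_Mapping.single k (Poly_Mapping.lookup p k)) k
      = (\<Sum>j\<in>Poly_Mapping.keys p. if j = k then Poly_Mapping.lookup p j else 0)"
    by (simp add: lookup_sum lookup_single when_def)
  also have "\<dots> = Poly_Mapping.lookup p k"
    by (simp add: sum.delta in_keys_iff)
  finally show "Poly_Mapping.lookup p k = Poly_Mapping.lookup (\<Sum>k\<in>Poly_Mapping.keys p. Poly_Mapping.single k (Poly_Mapping.lookup p k)) k" by simp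
qed

lemma const_commute: "const c * p = p * const c"
proof -
  have "const c * (\<Sum>k\<in>Poly_Mapping.keys p. Poly_Mapping.single k (Poly_Mapping.lookup p k))
      = (\<Sum>k\<in>Poly_Mapping.keys p. Poly_Mapping.single k (Poly_Mapping.lookup p k)) * const c"
    by (simp add: sum_distrib_left sum_distrib_right const_def mult_single mult.commute)
  then show ?thesis by (simp add: poly_mapping_eq_sum[symmetric])
qed

definition relators :: "free_alg set" where
  "relators =
    (let s = var Gs; t = var Gt; u = var Gu in
      { u * s * t * u - t * u * s * t,
        s * t * u * s * t - u * s * t * u * s,
        (s - const (par Gs I1)) * (s - const (par Gs I2)),
        (t - const (par Gt I1)) * (t - const (par Gt I2)),
        (u - const (par Gu I1)) * (u - const (par Gu I2)) })"

inductive_set relation_ideal :: "free_alg set" where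
  relator: "r \<in> relators \<Longrightarrow> r \<in> relation_ideal"
| zero: "0 \<in> relation_ideal"
| add: "x \<in> relation_ideal \<Longrightarrow> y \<in> relation_ideal \<Longrightarrow> x + y \<in> relation_ideal"
| left: "x \<in> relation_ideal \<Longrightarrow> a * x \<in> relation_ideal"
| right: "x \<in> relation_ideal \<Longrightarrow> x * a \<in> relation_ideal"

lemma relation_ideal_uminus: "x \<in> relation_ideal \<Longrightarrow> - x \<in> relation_ideal"
  using relation_ideal.left[of x "- 1"] by simp

text \<open>
  The ring class below includes \<open>0 \<noteq> 1\<close>, so the quotient has to be shown nontrivial.
  This uses the homomorphism to the integers sending all generators and parameters to 1.
\<close>

definition aug :: "('k \<Rightarrow>\<^sub>0 'b::comm_monoid_add) \<Rightarrow> 'b"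
  where "aug p = sum (Poly_Mapping.lookup p) (Poly_Mapping.keys p)"

lemma aug_superset: "finite A \<Longrightarrow> Poly_Mapping.keys p \<subseteq> A \<Longrightarrow> aug p = sum (Poly_Mapping.lookup p) A"
  unfolding aug_def by (rule sum.mono_neutral_left) (auto simp: in_keys_iff)

lemma aug_add: "aug (p + q) = aug p + aug q"
proof -
  let ?A = "Poly_Mapping.keys p \<union> Poly_Mapping.keys q"
  have "aug (p + q) = sum (Poly_Mapping.lookup (p + q)) ?A"
    by (rule aug_superset) (use Poly_Mapping.keys_add[of p q] in auto)
  moreover have "aug p = sum (Poly_Mapping.lookup p) ?A" "aug q = sum (Poly_Mapping.lookup q) ?A"
    by (rule aug_superset; simp)+
  ultimately show ?thesis by (simp add: lookup_add sum.distrib)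
qed

lemma aug_single: "aug (Poly_Mapping.single k c) = c"
  by (simp add: aug_def)

lemma aug_zero: "aug 0 = 0"
  by (simp add: aug_def)

lemma aug_one: "aug (1 :: 'k::zero \<Rightarrow>\<^sub>0 'b::semiring_1) = 1"
  by (simp add: aug_single flip: single_one)

lemma aug_sum: "aug (sum f A) = (\<Sum>a\<in>A. aug (f a))"
  by (induction A rule: infinite_finite_induct) (simp_all add: aug_zero aug_add)

lemma aug_diff: "aug (p - q) = aug p - aug (q :: 'k \<Rightarrow>\<^sub>0 'b::ab_group_add)"
  using aug_add[of "p - q" q] by (simp add: algebra_simps)

lemma aug_mult: "aug (p * q) = aug p * aug (q :: 'k::monoid_add \<Rightarrow>\<^sub>0 'b::semiring_0)"
proof -
  have "aug ((\<Sum>k\<in>Poly_Mapping.keys p. Poly_Mapping.single k (Poly_Mapping.lookup p k)) *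
             (\<Sum>k\<in>Poly_Mapping.keys q. Poly_Mapping.single k (Poly_Mapping.lookup q k))) = aug p * aug q"
    unfolding sum_product by (simp add: aug_sum mult_single aug_single) (simp add: aug_def sum_product)
  then show ?thesis by (simp add: poly_mapping_eq_sum[symmetric])
qed

lemma aug_relation_ideal: "x \<in> relation_ideal \<Longrightarrow> aug (aug x) = 0"
  by (induction rule: relation_ideal.induct)
     (auto simp: relators_def Let_def var_def const_def par_def
                 aug_mult aug_add aug_diff aug_single aug_zero aug_one)

lemma one_notin_relation_ideal: "1 \<notin> relation_ideal"
  using aug_relation_ideal[of 1] by (auto simp: aug_one)

definition hecke_rel :: "free_alg \<Rightarrow> free_alg \<Rightarrow> bool"
  where "hecke_rel x y \<longleftrightarrow> x - y \<in> relation_ideal"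

lemma equivp_hecke_rel: "equivp hecke_rel"
proof (rule equivpI)
  show "reflp hecke_rel"
    by (auto simp: reflp_def hecke_rel_def relation_ideal.zero)
  show "symp hecke_rel"
    unfolding symp_def hecke_rel_def using relation_ideal_uminus by fastforce
  show "transp hecke_rel"
    unfolding transp_def hecke_rel_def using relation_ideal.add by fastforce
qed

quotient_type hecke = free_alg / hecke_rel
  by (rule equivp_hecke_rel)

instantiation hecke :: ring_1
begin

lift_definition zero_hecke :: hecke is 0 .

lift_definition one_hecke :: hecke is 1 .

lift_definition plus_hecke :: "hecke \<Rightarrow> hecke \<Rightarrow> hecke" is "(+)"
  unfolding hecke_rel_def using relation_ideal.add by (fastforce simp: algebra_simps)

lift_definition uminus_hecke :: "hecke \<Rightarrow> hecke" is uminus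
  unfolding hecke_rel_def using relation_ideal_uminus by fastforce

lift_definition minus_hecke :: "hecke \<Rightarrow> hecke \<Rightarrow> hecke" is "(-)"
proof -
  fix a b c d assume "hecke_rel a b" "hecke_rel c d"
  then have "(a - b) + - (c - d) \<in> relation_ideal"
    unfolding hecke_rel_def by (intro relation_ideal.add relation_ideal_uminus)
  then show "hecke_rel (a - c) (b - d)"
    by (simp add: hecke_rel_def algebra_simps)
qed

lift_definition times_hecke :: "hecke \<Rightarrow> hecke \<Rightarrow> hecke" is "(*)"
proof -
  fix a b c d assume "hecke_rel a b" "hecke_rel c d"
  then have "(a - b) * c + b * (c - d) \<in> relation_ideal"
    unfolding hecke_rel_def by (intro relation_ideal.add relation_ideal.left relation_ideal.right)
  then show "hecke_rel (a * c) (b * d)"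
    by (simp add: hecke_rel_def algebra_simps)
qed

instance
proof
  show "(0::hecke) \<noteq> 1"
    by transfer (use one_notin_relation_ideal relation_ideal_uminus in \<open>fastforce simp: hecke_rel_def\<close>)
qed (transfer; simp add: hecke_rel_def relation_ideal.zero algebra_simps)+

end

lift_definition scale_hecke :: "laurent \<Rightarrow> hecke \<Rightarrow> hecke" is "\<lambda>c x. const c * x"
proof -
  fix c x y assume "hecke_rel x y"
  then have "const c * (x - y) \<in> relation_ideal"
    unfolding hecke_rel_def by (rule relation_ideal.left)
  then show "hecke_rel (const c * x) (const c * y)"
    by (simp add: hecke_rel_def algebra_simps)
qed

lift_definition gen_s :: hecke is "var Gs" .
lift_definition gen_t :: hecke is "var Gt" .
lift_definition gen_u :: hecke is "var Gu" .

interpretation hecke: module scale_hecke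
  by unfold_locales
     (transfer; simp add: hecke_rel_def relation_ideal.zero const_add const_mult const_1 algebra_simps)+

lemma scale_hecke_mult_left: "scale_hecke c x * y = scale_hecke c (x * y)"
  by transfer (simp add: hecke_rel_def relation_ideal.zero mult.assoc)

lemma scale_hecke_mult_right: "x * scale_hecke c y = scale_hecke c (x * y)"
proof transfer
  fix x c y
  have "x * (const c * y) = const c * (x * y)"
    by (metis const_commute mult.assoc)
  then show "hecke_rel (x * (const c * y)) (const c * (x * y))"
    by (simp add: hecke_rel_def relation_ideal.zero)
qed

lemma hecke_relations:
  "gen_u * gen_s * gen_t * gen_u = gen_t * gen_u * gen_s * gen_t"
  "gen_s * gen_t * gen_u * gen_s * gen_t = gen_u * gen_s * gen_t * gen_u * gen_s"
  "(gen_s - scale_hecke (par Gs I1) 1) * (gen_s - scale_hecke (par Gs I2) 1) = 0"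
  "(gen_t - scale_hecke (par Gt I1) 1) * (gen_t - scale_hecke (par Gt I2) 1) = 0"
  "(gen_u - scale_hecke (par Gu I1) 1) * (gen_u - scale_hecke (par Gu I2) 1) = 0"
  by (transfer; simp add: hecke_rel_def relation_ideal.relator relators_def Let_def)+

definition subalgebra :: "hecke set \<Rightarrow> bool" where
  "subalgebra A \<longleftrightarrow> hecke.subspace A \<and> 1 \<in> A \<and> (\<forall>x\<in>A. \<forall>y\<in>A. x * y \<in> A)"

definition generated_subalgebra :: "hecke set \<Rightarrow> hecke set"
  where "generated_subalgebra X = subalgebra hull X"

lemma subalgebra_generated: "subalgebra (generated_subalgebra X)"
  unfolding generated_subalgebra_def
  by (rule hull_in) (auto simp: subalgebra_def hecke.subspace_def)

definition u1 :: "hecke set" where "u1 = generated_subalgebra {gen_s}"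
definition u2 :: "hecke set" where "u2 = generated_subalgebra {gen_t}"
definition u3 :: "hecke set" where "u3 = generated_subalgebra {gen_u}"

text \<open>
  The product \<open>XY\<close> of two subsets is the submodule spanned by the elementwise products.
  In contrast, \<open>+\<close>, \<open>\<Sum>\<close> and \<open>*o\<close> on sets below are the elementwise
  operations, which on submodules give the sum of submodules and the translate \<open>zX\<close>.
\<close>

definition set_prod :: "hecke set \<Rightarrow> hecke set \<Rightarrow> hecke set" (infixl \<open>\<star>\<close> 75)
  where "X \<star> Y = hecke.span {x * y | x y. x \<in> X \<and> y \<in> Y}"

definition central_z :: hecke where "central_z = (gen_s * gen_t * gen_u) ^ 3"

definition U_G13 :: "hecke set" where
  "U_G13 = (\<Sum>k\<in>{0..3::nat}. (central_z ^ k) *o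
     (u1 \<star> u2 \<star> u1 \<star> u2 + u1 \<star> u2 \<star> u3 \<star> u2 + u2 \<star> u3 \<star> u1 \<star> u2
      + u2 \<star> u1 \<star> u3 \<star> u2 + u3 \<star> u2 \<star> u1 \<star> u2))"

end

theory Submission
  imports Defs
begin

text \<open>
  Put \<open>x = stu\<close> and \<open>y = ux\<close>. The braid relations amount to \<open>z = x\<^sup>3\<close> being
  central, with \<open>s = z y\<^sup>-\<^sup>2\<close> and \<open>t = y u y\<^sup>-\<^sup>1\<close>; so the braid group
  modulo \<open>z\<close> is the free product of a cyclic group of order 3, generated by \<open>x\<close>, and the
  infinite cyclic group generated by \<open>u\<close>, and words in \<open>x\<close> and \<open>u\<close> have an
  obvious normal form.

  Let \<open>M\<close> be the span of the elements \<open>z\<^sup>k g t\<^sup>j\<close> with \<open>k \<le> 3\<close>,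
  \<open>j \<le> 1\<close> and \<open>g\<close> one of twelve words. It is a right module over the algebra
  generated by \<open>t = y u y\<^sup>-\<^sup>1\<close>, so \<open>My\<close> is stable under right multiplication by
  \<open>u\<close>, and whether it contains a group element depends only on the coset modulo
  \<open>u\<close>. A quadratic relation with invertible constant term says that, of three elements
  \<open>p r q\<close>, \<open>p q\<close>, \<open>p r\<^sup>-\<^sup>1 q\<close> with \<open>r\<close> one of \<open>s\<close>,
  \<open>u\<close>, two adjacent ones in \<open>My\<close> force the third into it. Starting from the 48 cosets that
  span \<open>My\<close>, this single rule reaches all their left multiples by \<open>s\<close>, \<open>t\<close>,
  \<open>u\<close>; hence \<open>M\<close> is a left ideal containing 1.
\<close>

section \<open>Integer powers of units\<close>

definition unit_pair :: "'a::monoid_mult \<Rightarrow> 'a \<Rightarrow> bool"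
  where "unit_pair g h \<longleftrightarrow> g * h = 1 \<and> h * g = 1"

text \<open>The type has no inverse operation, so \<open>SOME\<close> picks one; the value is
  meaningful only for invertible \<open>g\<close>, and likewise \<open>zpower\<close> at negative
  exponents.\<close>

definition unit_inv :: "'a::monoid_mult \<Rightarrow> 'a"
  where "unit_inv g = (SOME h. unit_pair g h)"

definition zpower :: "'a::monoid_mult \<Rightarrow> int \<Rightarrow> 'a"
  where "zpower g n = (if n \<ge> 0 then g ^ nat n else unit_inv g ^ nat (- n))"

definition invertible :: "'a::monoid_mult \<Rightarrow> bool"
  where "invertible g \<longleftrightarrow> (\<exists>h. unit_pair g h)"

lemma invertibleI: "g * h = 1 \<Longrightarrow> h * g = 1 \<Longrightarrow> invertible g"
  by (auto simp: invertible_def unit_pair_def)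

lemma unit_inv:
  assumes "invertible g"
  shows "g * unit_inv g = 1" "unit_inv g * g = 1"
proof -
  have "unit_pair g (unit_inv g)"
    using assms unfolding invertible_def unit_inv_def by (rule someI_ex)
  then show "g * unit_inv g = 1" "unit_inv g * g = 1"
    by (auto simp: unit_pair_def)
qed

lemma unit_inv_cancel:
  assumes "invertible g"
  shows "g * (unit_inv g * a) = a" "unit_inv g * (g * a) = a"
  using unit_inv[OF assms] by (simp_all flip: mult.assoc)

lemma invertible_mult:
  assumes "invertible g" "invertible h"
  shows "invertible (g * h)"
  by (rule invertibleI[of _ "unit_inv h * unit_inv g"])
     (simp_all add: mult.assoc unit_inv_cancel unit_inv assms)

lemma invertible_cancel_right:
  assumes "invertible g" "a * g = b * g"
  shows "a = b"
proof -
  have "a * g * unit_inv g = b * g * unit_inv g"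
    using assms(2) by simp
  then show ?thesis
    by (simp add: mult.assoc unit_inv assms(1))
qed

lemma zpower_simps: "zpower g 0 = 1" "zpower g 1 = g" "zpower g (- 1) = unit_inv g"
  by (simp_all add: zpower_def)

lemma zpower_of_nat: "zpower g (int n) = g ^ n"
  by (simp add: zpower_def)

lemma zpower_add_one:
  assumes "invertible g"
  shows "zpower g (n + 1) = g * zpower g n"
proof (cases "n \<ge> 0")
  case True
  then show ?thesis
    by (simp add: zpower_def nat_add_distrib)
next
  case False
  then obtain m where "n = - int (Suc m)"
    by (metis not_le int_cases nonneg_int_cases negative_eq_positive of_nat_0_le_iff)
  then show ?thesis
    by (auto simp: zpower_def nat_add_distrib unit_inv_cancel[OF assms] simp del: of_nat_Suc)
       (simp add: zpower_def unit_inv_cancel[OF assms])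
qed

lemma zpower_diff_one:
  assumes "invertible g"
  shows "zpower g (n - 1) = unit_inv g * zpower g n"
  using zpower_add_one[OF assms, of "n - 1"] by (simp add: unit_inv_cancel[OF assms])

lemma zpower_add:
  assumes "invertible g"
  shows "zpower g (m + n) = zpower g m * zpower g n"
proof (induction m rule: int_induct[where k = 0])
  case base
  then show ?case by (simp add: zpower_simps)
next
  case (step1 i)
  have "zpower g (i + 1 + n) = g * zpower g (i + n)"
    using zpower_add_one[OF assms, of "i + n"] by (simp add: algebra_simps)
  then show ?case
    by (simp add: step1 zpower_add_one[OF assms] mult.assoc)
next
  case (step2 i)
  have "zpower g (i - 1 + n) = unit_inv g * zpower g (i + n)"
    using zpower_diff_one[OF assms, of "i + n"] by (simp add: algebra_simps)
  then show ?case
    by (simp add: step2 zpower_diff_one[OF assms] mult.assoc)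
qed

text \<open>For \<open>a = ustu\<close> this carries powers of u to powers of t; for
  \<open>g = h\<close> it extends commutation to all integer powers.\<close>

lemma zpower_intertwine:
  assumes "invertible g" "invertible h" "a * g = h * a"
  shows "a * zpower g n = zpower h n * a"
proof (induction n rule: int_induct[where k = 0])
  case base
  then show ?case by (simp add: zpower_simps)
next
  case (step1 i)
  have "a * zpower g (i + 1) = h * (a * zpower g i)"
    using assms(3) by (simp add: zpower_add_one[OF assms(1)] flip: mult.assoc)
  then show ?case
    by (simp add: step1 zpower_add_one[OF assms(2)] mult.assoc)
next
  case (step2 i)
  have "h * (a * zpower g (i - 1)) = a * (g * zpower g (i - 1))"
    using assms(3) by (simp flip: mult.assoc)
  also have "\<dots> = a * zpower g i"
    by (simp add: zpower_diff_one[OF assms(1)] unit_inv_cancel[OF assms(1)])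
  finally have "h * (a * zpower g (i - 1)) = a * zpower g i" .
  then have "a * zpower g (i - 1) = unit_inv h * (a * zpower g i)"
    using unit_inv_cancel(2)[OF assms(2), of "a * zpower g (i - 1)"] by simp
  then show ?case
    by (simp add: step2 zpower_diff_one[OF assms(2)] mult.assoc)
qed

section \<open>The generators and the central element\<close>

fun hecke_gen :: "gen \<Rightarrow> hecke" where
  "hecke_gen Gs = gen_s"
| "hecke_gen Gt = gen_t"
| "hecke_gen Gu = gen_u"

text \<open>Expanding the product gives g(a + b - g) = ab. As ab is a unit, h = (ab)^(-1) (a + b -
  g) is a two-sided inverse of g, and g = (a + b) - ab h, so d = -ab.\<close>

lemma quadratic_unit:
  fixes g :: hecke
  assumes "(g - scale_hecke a 1) * (g - scale_hecke b 1) = 0" "a dvd 1" "b dvd 1"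
  obtains c d h where "g * h = 1" "h * g = 1" "g = scale_hecke c 1 + scale_hecke d h" "d dvd 1"
proof -
  obtain a' where a': "1 = a * a'" using assms(2) by (elim dvdE)
  obtain b' where b': "1 = b * b'" using assms(3) by (elim dvdE)
  define e e' where "e = a * b" and "e' = a' * b'"
  have "e * e' = (a * a') * (b * b')"
    by (simp only: e_def e'_def mult_ac)
  then have ee: "e * e' = 1" "e' * e = 1"
    using a' b' by (simp_all add: mult.commute)
  have "(g - scale_hecke a 1) * (g - scale_hecke b 1)
      = g * g - scale_hecke (a + b) g + scale_hecke e 1"
    by (simp add: left_diff_distrib right_diff_distrib scale_hecke_mult_left scale_hecke_mult_right
        hecke.scale_left_distrib hecke.scale_right_diff_distrib e_def mult.commute)
  then have "g * g - scale_hecke (a + b) g + scale_hecke e 1 = 0"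
    using assms(1) by (simp only:)
  then have eq: "scale_hecke (a + b) g - g * g = scale_hecke e 1"
    by (simp add: algebra_simps)
  define h where "h = scale_hecke e' (scale_hecke (a + b) 1 - g)"
  have gh: "g * h = 1"
    by (simp add: h_def scale_hecke_mult_right right_diff_distrib eq ee)
  have hg: "h * g = 1"
    by (simp add: h_def scale_hecke_mult_left left_diff_distrib eq ee)
  have "scale_hecke e h = scale_hecke (a + b) 1 - g"
    by (simp add: h_def ee)
  then have "g = scale_hecke (a + b) 1 + scale_hecke (- e) h"
    by simp
  moreover have "- e dvd 1"
    using ee by (metis dvd_triv_right minus_dvd_iff)
  ultimately show ?thesis
    using that gh hg by blast
qed

lemma gen_quadratic:
  obtains c d where "invertible (hecke_gen g)"
    "hecke_gen g = scale_hecke c 1 + scale_hecke d (unit_inv (hecke_gen g))" "d dvd 1"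
proof -
  have "(hecke_gen g - scale_hecke (par g I1) 1) * (hecke_gen g - scale_hecke (par g I2) 1) = 0"
    by (cases g) (simp_all add: hecke_relations)
  then obtain c d h where h: "hecke_gen g * h = 1" "h * hecke_gen g = 1"
      "hecke_gen g = scale_hecke c 1 + scale_hecke d h" "d dvd 1"
    by (rule quadratic_unit[OF _ par_dvd_1 par_dvd_1])
  then have inv: "invertible (hecke_gen g)" by (rule_tac invertibleI)
  have "unit_inv (hecke_gen g) = h"
    using unit_inv_cancel(2)[OF inv, of h] h(1) by simp
  with inv h that show ?thesis by metis
qed

lemma invertible_gen [simp]: "invertible gen_s" "invertible gen_t" "invertible gen_u"
  using gen_quadratic[of Gs] gen_quadratic[of Gt] gen_quadratic[of Gu] by auto

section \<open>The elements x = stu, y = ustu and z = x^3\<close>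

definition stu :: hecke where "stu = gen_s * gen_t * gen_u"
definition ustu :: hecke where "ustu = gen_u * stu"

lemma invertible_xy [simp]: "invertible stu" "invertible ustu"
  by (simp_all add: stu_def ustu_def invertible_mult)

lemma central_z_x: "central_z = stu * stu * stu"
  by (simp add: central_z_def stu_def power3_eq_cube)

lemma invertible_z [simp]: "invertible central_z"
  by (simp add: central_z_x invertible_mult)

lemma ustu_eq: "ustu = gen_t * gen_u * gen_s * gen_t"
  by (simp add: ustu_def stu_def hecke_relations(1) flip: mult.assoc)

text \<open>The first braid relation says y = tust, so ty = t(ustu) = (tust)u = yu: conjugation by y
  turns u into t.\<close>

lemma t_y: "gen_t * ustu = ustu * gen_u"
proof -
  have "gen_t * ustu = gen_t * gen_u * gen_s * gen_t * gen_u"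
    by (simp add: ustu_def stu_def mult.assoc)
  then show ?thesis by (simp add: ustu_eq)
qed

text \<open>From y = tust, sy = stust, which the second braid relation rewrites to ustus =
  ys.\<close>

lemma s_y: "gen_s * ustu = ustu * gen_s"
proof -
  have "gen_s * ustu = gen_s * gen_t * gen_u * gen_s * gen_t"
    by (simp only: ustu_eq mult.assoc)
  also have "\<dots> = ustu * gen_s"
    by (simp only: hecke_relations(2)) (simp only: ustu_def stu_def mult.assoc)
  finally show ?thesis .
qed

lemma s_y_u: "gen_s * ustu * gen_u = stu * stu"
  by (simp add: ustu_eq stu_def mult.assoc)

text \<open>Since x^2 = syu and ux = y, x^3 = (syu)x = s y^2. In this form commutation with y
  follows from that of s.\<close>

lemma z_eq: "central_z = gen_s * ustu * ustu"
  by (metis central_z_x s_y_u mult.assoc ustu_def)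

lemma z_y: "central_z * ustu = ustu * central_z"
  by (metis z_eq s_y mult.assoc)

lemma z_x: "central_z * stu = stu * central_z"
  by (simp add: central_z_x mult.assoc)

text \<open>z commutes with y = ux and with x; cancelling x on the right leaves u.\<close>

lemma z_u: "central_z * gen_u = gen_u * central_z"
  by (rule invertible_cancel_right[OF invertible_xy(1)]) (metis ustu_def z_y z_x mult.assoc)

lemma zpower_z_comm: 
  assumes "central_z * a = a * central_z"
  shows "zpower central_z k * a = a * zpower central_z k"
  using zpower_intertwine[OF invertible_z invertible_z assms[symmetric]] by simp

lemma z_right:
  "central_z * (gen_u * a) = gen_u * (central_z * a)" "central_z * (stu * a) = stu * (central_z * a)"
  by (metis mult.assoc z_u) (metis mult.assoc z_x)

lemma x_cubed: "stu * (stu * stu) = central_z" "stu * (stu * (stu * a)) = central_z * a"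
  by (simp_all add: central_z_x mult.assoc)

text \<open>By x^3 = z, the inverse of y is z^(-1) x^2 u^(-1), so s = z y^(-2) takes this form. The
  proof multiplies by y^2 and cancels.\<close>

lemma s_eq: "zpower central_z (- 1) * (stu * stu * unit_inv gen_u * (stu * stu) * unit_inv gen_u) = gen_s"
proof -
  have "stu * stu * unit_inv gen_u * (stu * stu) * unit_inv gen_u * (ustu * ustu) = central_z * central_z"
    by (simp add: ustu_def mult.assoc unit_inv_cancel x_cubed z_right z_x)
  then have "zpower central_z (- 1) * (stu * stu * unit_inv gen_u * (stu * stu) * unit_inv gen_u) * (ustu * ustu)
      = central_z"
    by (simp add: zpower_simps mult.assoc unit_inv_cancel)
  also have "\<dots> = gen_s * (ustu * ustu)"
    by (simp add: z_eq mult.assoc)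
  finally show ?thesis
    by (rule invertible_cancel_right[rotated]) (simp add: invertible_mult)
qed

text \<open>This is z^(-1) y^2, the inverse of s because z = s y^2.\<close>

lemma s_inv_eq: "zpower central_z (- 1) * (gen_u * stu * gen_u * stu) = unit_inv gen_s"
proof -
  have "gen_s * (ustu * ustu) = central_z"
    by (simp add: z_eq mult.assoc)
  then have yy: "ustu * ustu = unit_inv gen_s * central_z"
    by (metis unit_inv_cancel(2) invertible_gen(1))
  have "zpower central_z (- 1) * (gen_u * stu * gen_u * stu) = ustu * ustu * zpower central_z (- 1)"
    by (subst zpower_z_comm) (simp_all add: ustu_def mult.assoc z_right z_x)
  also have "\<dots> = unit_inv gen_s"
    by (simp add: yy mult.assoc zpower_simps unit_inv)
  finally show ?thesis .
qed

text \<open>This is y u y^(-1) with y^(-1) = z^(-1) x^2 u^(-1).\<close>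

lemma t_eq: "zpower central_z (- 1) * (gen_u * stu * gen_u * (stu * stu) * unit_inv gen_u) = gen_t"
proof -
  have "gen_u * stu * gen_u * (stu * stu) * unit_inv gen_u * ustu = central_z * (gen_u * stu * gen_u)"
    by (simp add: ustu_def mult.assoc unit_inv_cancel x_cubed z_right z_u)
  then have "zpower central_z (- 1) * (gen_u * stu * gen_u * (stu * stu) * unit_inv gen_u) * ustu
      = ustu * gen_u"
    by (simp add: zpower_simps mult.assoc unit_inv_cancel) (simp add: ustu_def mult.assoc)
  also have "\<dots> = gen_t * ustu"
    by (simp add: t_y)
  finally show ?thesis
    by (rule invertible_cancel_right[rotated]) simp
qed

section \<open>Cosets of the subgroup generated by u\<close>

text \<open>
  A pair \<open>(k, w)\<close> stands for \<open>z\<^sup>k w\<close> modulo right multiplication by powers of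
  \<open>u\<close>; \<open>X\<close>, \<open>XX\<close> and \<open>V n\<close> stand for \<open>x\<close>,
  \<open>x\<^sup>2\<close> and \<open>u\<^sup>n\<close>. The word \<open>[V 1, X]\<close> is \<open>y\<close>.
\<close>

datatype letter = X | XX | V int

type_synonym coset = "int \<times> letter list"

fun shift :: "int \<Rightarrow> coset \<Rightarrow> coset"
  where "shift j (k, w) = (k + j, w)"

fun mult_x :: "coset \<Rightarrow> coset" where
  "mult_x (k, X # w) = (k, XX # w)"
| "mult_x (k, XX # w) = (k + 1, w)"
| "mult_x (k, w) = (k, X # w)"

text \<open>The empty word is the coset of the subgroup itself, which absorbs u. Exponents adding up
  to 0 remove the letter, so that normal forms stay reduced.\<close>

fun mult_u :: "int \<Rightarrow> coset \<Rightarrow> coset" where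
  "mult_u n (k, []) = (k, [])"
| "mult_u n (k, V m # w) = (k, if n + m = 0 then w else V (n + m) # w)"
| "mult_u n (k, w) = (k, V n # w)"

fun mult_letter :: "letter \<Rightarrow> coset \<Rightarrow> coset" where
  "mult_letter X q = mult_x q"
| "mult_letter XX q = mult_x (mult_x q)"
| "mult_letter (V n) q = mult_u n q"

abbreviation mult_word :: "letter list \<Rightarrow> coset \<Rightarrow> coset"
  where "mult_word \<equiv> foldr mult_letter"

text \<open>The words for s and t are those of \<open>s_eq\<close> and \<open>t_eq\<close>;
  \<open>shift (- 1)\<close> is their factor z^(-1).\<close>

fun mult_gen :: "gen \<Rightarrow> coset \<Rightarrow> coset" where
  "mult_gen Gs q = shift (- 1) (mult_word [XX, V (- 1), XX, V (- 1)] q)"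
| "mult_gen Gt q = shift (- 1) (mult_word [V 1, X, V 1, XX, V (- 1)] q)"
| "mult_gen Gu q = mult_u 1 q"

text \<open>A prime marks the inverse. As t is conjugate to u by y, its quadratic relation is that
  of u applied behind a suitable prefix.\<close>

datatype reflection = S | S' | U | U'

fun opposite :: "reflection \<Rightarrow> reflection" where
  "opposite S = S'" | "opposite S' = S" | "opposite U = U'" | "opposite U' = U"

fun mult_refl :: "reflection \<Rightarrow> coset \<Rightarrow> coset" where
  "mult_refl S q = mult_gen Gs q"
| "mult_refl S' q = shift (- 1) (mult_word [V 1, X, V 1, X] q)"
| "mult_refl U q = mult_u 1 q"
| "mult_refl U' q = mult_u (- 1) q"

section \<open>Evaluation of the coset calculus in the algebra\<close>

fun letter_val :: "letter \<Rightarrow> hecke" where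
  "letter_val X = stu"
| "letter_val XX = stu * stu"
| "letter_val (V n) = zpower gen_u n"

definition word_val :: "letter list \<Rightarrow> hecke"
  where "word_val w = prod_list (map letter_val w)"

fun coset_val :: "coset \<Rightarrow> hecke"
  where "coset_val (k, w) = zpower central_z k * word_val w"

fun refl_val :: "reflection \<Rightarrow> hecke" where
  "refl_val S = gen_s"
| "refl_val S' = unit_inv gen_s"
| "refl_val U = gen_u"
| "refl_val U' = unit_inv gen_u"

definition same_coset :: "hecke \<Rightarrow> hecke \<Rightarrow> bool"
  where "same_coset a b \<longleftrightarrow> (\<exists>n. a = b * zpower gen_u n)"

lemma same_coset_refl [simp]: "same_coset a a"
  unfolding same_coset_def by (rule exI[of _ 0]) (simp add: zpower_simps)

lemma same_coset_trans [trans]: "same_coset a b \<Longrightarrow> same_coset b c \<Longrightarrow> same_coset a c"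
  unfolding same_coset_def by (metis zpower_add[OF invertible_gen(3)] mult.assoc)

lemma same_coset_mult: "same_coset a b \<Longrightarrow> same_coset (c * a) (c * b)"
  unfolding same_coset_def by (metis mult.assoc)

lemma zpower_z_commute:
  "zpower central_z k * stu = stu * zpower central_z k"
  "zpower central_z k * zpower gen_u n = zpower gen_u n * zpower central_z k"
  by (simp_all add: zpower_z_comm z_x z_u zpower_intertwine[where h = gen_u])

lemma zpower_z_left:
  "stu * (zpower central_z k * a) = zpower central_z k * (stu * a)"
  "zpower gen_u n * (zpower central_z k * a) = zpower central_z k * (zpower gen_u n * a)"
  by (metis mult.assoc zpower_z_commute(1)) (metis mult.assoc zpower_z_commute(2))

lemma zpower_u_left: "zpower gen_u m * (zpower gen_u n * a) = zpower gen_u (m + n) * a"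
  by (simp add: zpower_add mult.assoc)

lemma coset_val_shift: "coset_val (shift j q) = zpower central_z j * coset_val q"
  by (cases q) (simp add: zpower_add add.commute[of _ j] mult.assoc)

lemma coset_val_mult_x: "stu * coset_val q = coset_val (mult_x q)"
  by (cases q rule: mult_x.cases)
     (simp_all add: word_val_def zpower_z_left zpower_add zpower_simps mult.assoc x_cubed
       flip: zpower_z_commute(1))

lemma coset_val_mult_u: "same_coset (zpower gen_u n * coset_val q) (coset_val (mult_u n q))"
proof (cases "(n, q)" rule: mult_u.cases)
  \<comment> \<open>Only here is a power of u lost: it moves to the right past the central factor.
    All other cases are equalities.\<close>
  case (1 n' k)
  then show ?thesis
    by (auto simp: same_coset_def word_val_def zpower_z_commute)
next
  case (2 n' k m w)
  then have "zpower gen_u n * coset_val q = coset_val (mult_u n q)"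
    by (auto simp: word_val_def zpower_z_left zpower_u_left zpower_simps)
  then show ?thesis by simp
qed (simp_all add: word_val_def zpower_z_left)

lemma coset_val_mult_letter: "same_coset (letter_val l * coset_val q) (coset_val (mult_letter l q))"
  by (cases l) (simp_all add: coset_val_mult_u mult.assoc flip: coset_val_mult_x)

lemma coset_val_mult_word: "same_coset (word_val p * coset_val q) (coset_val (mult_word p q))"
proof (induction p)
  case (Cons l p)
  have "same_coset (letter_val l * (word_val p * coset_val q)) (letter_val l * coset_val (mult_word p q))"
    by (rule same_coset_mult[OF Cons])
  also have "same_coset \<dots> (coset_val (mult_word (l # p) q))"
    using coset_val_mult_letter by simp
  finally show ?case
    by (simp add: word_val_def mult.assoc)
qed (simp add: word_val_def)

lemma coset_val_shift_mult_word:
  "same_coset (zpower central_z j * word_val p * coset_val q) (coset_val (shift j (mult_word p q)))"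
  unfolding coset_val_shift mult.assoc by (rule same_coset_mult[OF coset_val_mult_word])

lemma coset_val_mult_gen: "same_coset (hecke_gen g * coset_val q) (coset_val (mult_gen g q))"
proof (cases g)
  case Gs
  have "hecke_gen Gs = zpower central_z (- 1) * word_val [XX, V (- 1), XX, V (- 1)]"
    using s_eq by (simp add: word_val_def zpower_simps mult.assoc)
  with Gs show ?thesis
    using coset_val_shift_mult_word by (metis mult_gen.simps(1))
next
  case Gt
  have "hecke_gen Gt = zpower central_z (- 1) * word_val [V 1, X, V 1, XX, V (- 1)]"
    using t_eq by (simp add: word_val_def zpower_simps mult.assoc)
  with Gt show ?thesis
    using coset_val_shift_mult_word by (metis mult_gen.simps(2))
next
  case Gu
  then show ?thesis
    using coset_val_mult_u[of 1] by (simp add: zpower_simps)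
qed

lemma coset_val_mult_refl: "same_coset (refl_val r * coset_val q) (coset_val (mult_refl r q))"
proof (cases r)
  case S
  then show ?thesis using coset_val_mult_gen[of Gs] by simp
next
  case S'
  have "refl_val S' = zpower central_z (- 1) * word_val [V 1, X, V 1, X]"
    using s_inv_eq by (simp add: word_val_def zpower_simps mult.assoc)
  with S' show ?thesis
    using coset_val_shift_mult_word by (metis mult_refl.simps(2))
next
  case U
  then show ?thesis using coset_val_mult_u[of 1] by (simp add: zpower_simps)
next
  case U'
  then show ?thesis using coset_val_mult_u[of "- 1"] by (simp add: zpower_simps)
qed

section \<open>Membership in the spanned submodule\<close>

text \<open>Together with four powers of z and two powers of t these words give 96 elements, 96
  being the order of the reflection group G_13. Each word is a product of factors fitting the first
  three places of one of the five summands of U.\<close>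

definition transversal :: "gen list list" where
  "transversal = [[], [Gs], [Gt, Gs], [Gs, Gt, Gs], [Gu], [Gs, Gu], [Gt, Gu], [Gs, Gt, Gu],
     [Gu, Gs], [Gt, Gu, Gs], [Gt, Gs, Gu], [Gu, Gt, Gs]]"

definition gens_val :: "gen list \<Rightarrow> hecke"
  where "gens_val r = prod_list (map hecke_gen r)"

definition basis_span :: "hecke set" where
  "basis_span = hecke.span {central_z ^ k * (gens_val r * gen_t ^ j) | k r j.
     k \<le> 3 \<and> r \<in> set transversal \<and> j \<le> 1}"

text \<open>The start \<open>[V 1, X]\<close> is y, so this is the coset of z^k r y, with r the
  given word, which lies in My.\<close>

definition basic_coset :: "nat \<Rightarrow> gen list \<Rightarrow> coset"
  where "basic_coset k r = shift (int k) (foldr mult_gen r (0, [V 1, X]))"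

text \<open>The whole coset lies in My, expressed by dividing by y on the right. Quantifying over
  \<open>n\<close> makes the property independent of the representative.\<close>

definition known :: "coset \<Rightarrow> bool" where
  "known q \<longleftrightarrow> (\<forall>n. coset_val q * zpower gen_u n * unit_inv ustu \<in> basis_span)"

lemma known_same_coset:
  assumes "same_coset a (coset_val q)"
  shows "known q \<longleftrightarrow> (\<forall>n. a * zpower gen_u n * unit_inv ustu \<in> basis_span)"
proof -
  obtain m where m: "a = coset_val q * zpower gen_u m"
    using assms by (auto simp: same_coset_def)
  have "a * zpower gen_u n = coset_val q * zpower gen_u (m + n)" for n
    by (simp add: m zpower_add mult.assoc)
  moreover have "coset_val q * zpower gen_u n = a * zpower gen_u (- m + n)" for n
    by (simp add: m mult.assoc flip: zpower_add)
  ultimately show ?thesis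
    unfolding known_def by metis
qed

text \<open>For \<open>S\<close> and \<open>U\<close> this is the quadratic relation divided by the
  generator; for the inverses that relation is solved in the other direction, which is possible
  because its coefficient d is a unit.\<close>

lemma refl_val_opposite:
  obtains c d where "refl_val r = scale_hecke c 1 + scale_hecke d (refl_val (opposite r))" "d dvd 1"
proof -
  have aux: "\<exists>c d. (g = scale_hecke c 1 + scale_hecke d h) \<and> d dvd 1"
    if hg: "h = scale_hecke c 1 + scale_hecke d g" "d dvd 1" for c d g h
  proof -
    obtain d' where d': "1 = d * d'" using hg(2) by (elim dvdE)
    have "scale_hecke d' h = scale_hecke (d' * c) 1 + g"
      using d' by (simp add: hg(1) hecke.scale_right_distrib mult.commute)
    then have "g = scale_hecke (- (d' * c)) 1 + scale_hecke d' h"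
      by simp
    moreover have "d' dvd 1" using d' by (metis dvd_triv_right)
    ultimately show ?thesis by blast
  qed
  obtain c d where s: "gen_s = scale_hecke c 1 + scale_hecke d (unit_inv gen_s)" "d dvd 1"
    using gen_quadratic[of Gs] by auto
  obtain c' d' where u: "gen_u = scale_hecke c' 1 + scale_hecke d' (unit_inv gen_u)" "d' dvd 1"
    using gen_quadratic[of Gu] by auto
  show thesis
  proof (cases r)
    case S then show ?thesis using that s by auto
  next
    case S' then show ?thesis using that aux[OF s] by auto
  next
    case U then show ?thesis using that u by auto
  next
    case U' then show ?thesis using that aux[OF u] by auto
  qed
qed

text \<open>
  With \<open>d\<close> a unit, \<open>r = c + d r\<^sup>-\<^sup>1\<close> lets any two neighbours among
  \<open>p r q\<close>, \<open>p q\<close>, \<open>p r\<^sup>-\<^sup>1 q\<close> determine the third.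
\<close>

lemma known_step:
  assumes "known (mult_word p q)" "known (mult_word p (mult_refl r q))"
  shows "known (mult_word p (mult_refl (opposite r) q))"
proof -
  have val: "same_coset (word_val p * (refl_val r * coset_val q)) (coset_val (mult_word p (mult_refl r q)))" for r
    by (rule same_coset_trans[OF same_coset_mult[OF coset_val_mult_refl] coset_val_mult_word])
  obtain c d where cd: "refl_val r = scale_hecke c 1 + scale_hecke d (refl_val (opposite r))" "d dvd 1"
    by (rule refl_val_opposite)
  obtain d' where d': "1 = d * d'" using cd(2) by (elim dvdE)
  show ?thesis
    unfolding known_same_coset[OF val]
  proof
    fix n
    let ?v = "coset_val q * zpower gen_u n * unit_inv ustu"
    have 1: "word_val p * ?v \<in> basis_span"
      using assms(1) known_same_coset[OF coset_val_mult_word] by (simp add: mult.assoc)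
    have 2: "word_val p * (refl_val r * ?v) \<in> basis_span"
      using assms(2) known_same_coset[OF val] by (simp add: mult.assoc)
    have "scale_hecke d (word_val p * (refl_val (opposite r) * ?v))
        = word_val p * (refl_val r * ?v) - scale_hecke c (word_val p * ?v)"
      by (simp add: cd(1) distrib_right distrib_left scale_hecke_mult_left scale_hecke_mult_right)
    also have "\<dots> \<in> basis_span"
      using 1 2 unfolding basis_span_def by (intro hecke.span_diff hecke.span_scale)
    finally have "scale_hecke d' (scale_hecke d (word_val p * (refl_val (opposite r) * ?v))) \<in> basis_span"
      unfolding basis_span_def by (rule hecke.span_scale)
    then show "word_val p * (refl_val (opposite r) * coset_val q) * zpower gen_u n * unit_inv ustu \<in> basis_span"
      using d' by (simp add: mult.commute[of d'] mult.assoc)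
  qed
qed

text \<open>Batch form of the rule: for a literal table the simplifier computes all normal forms,
  discharges the premises by earlier facts and leaves a conjunction of new ones.\<close>

lemma known_steps:
  assumes "list_all (\<lambda>(p, r, w, ks). list_all (\<lambda>k. known (mult_word p (k, w)) \<and>
    known (mult_word p (mult_refl r (k, w)))) ks) steps"
  shows "list_all (\<lambda>(p, r, w, ks). list_all (\<lambda>k.
    known (mult_word p (mult_refl (opposite r) (k, w)))) ks) steps"
  using assms known_step by (fastforce simp: list_all_iff)

section \<open>Starting cosets and reduction of left stability to cosets\<close>

lemma ustu_zpower_u: "ustu * zpower gen_u n * unit_inv ustu = zpower gen_t n"
proof -
  have "ustu * zpower gen_u n = zpower gen_t n * ustu"
    by (rule zpower_intertwine) (simp_all add: t_y)
  then show ?thesis by (simp add: mult.assoc unit_inv)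
qed

lemma basic_coset_val:
  "same_coset (central_z ^ k * (gens_val r * ustu)) (coset_val (basic_coset k r))"
proof -
  have "same_coset (gens_val r * ustu) (coset_val (foldr mult_gen r (0, [V 1, X])))"
  proof (induction r)
    case Nil
    then show ?case
      by (simp add: gens_val_def word_val_def zpower_simps ustu_def)
  next
    case (Cons g r)
    have "same_coset (hecke_gen g * (gens_val r * ustu))
        (hecke_gen g * coset_val (foldr mult_gen r (0, [V 1, X])))"
      by (rule same_coset_mult[OF Cons])
    also have "same_coset \<dots> (coset_val (foldr mult_gen (g # r) (0, [V 1, X])))"
      by (simp add: coset_val_mult_gen)
    finally show ?case
      by (simp add: gens_val_def mult.assoc)
  qed
  then show ?thesis
    unfolding basic_coset_def coset_val_shift zpower_of_nat by (rule same_coset_mult)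
qed

text \<open>By the quadratic relation both t^2 and t^(-1) are combinations of 1 and t, so the span
  is stable under multiplication by t and by its inverse.\<close>

lemma zpower_t_in_span: "zpower gen_t n \<in> hecke.span {1, gen_t}"
proof (induction n rule: int_induct[where k = 0])
  case base
  then show ?case by (simp add: zpower_simps hecke.span_base)
next
  obtain c d where cd: "gen_t = scale_hecke c 1 + scale_hecke d (unit_inv gen_t)" "d dvd 1"
    using gen_quadratic[of Gt] by auto
  obtain d' where d': "1 = d * d'" using cd(2) by (elim dvdE)
  have t_inv: "unit_inv gen_t = scale_hecke d' gen_t - scale_hecke (d' * c) 1"
    using d' by (subst cd(1)) (simp add: hecke.scale_right_distrib mult.commute)
  have "gen_t * gen_t = scale_hecke c gen_t + scale_hecke d 1"
    by (subst cd(1)) (simp add: distrib_right scale_hecke_mult_left unit_inv)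
  then have tt: "gen_t * gen_t \<in> hecke.span {1, gen_t}"
    by (simp add: hecke.span_add hecke.span_scale hecke.span_base)
  have mult_t: "gen_t * h \<in> hecke.span {1, gen_t}" if "h \<in> hecke.span {1, gen_t}" for h
    using that
    by (induction rule: hecke.span_induct_alt)
       (auto simp: distrib_left scale_hecke_mult_right hecke.span_zero tt
          intro!: hecke.span_add hecke.span_scale intro: hecke.span_base)
  {
    case (step1 i)
    then show ?case by (simp add: zpower_add_one mult_t)
  next
    case (step2 i)
    then show ?case
      by (simp add: zpower_diff_one t_inv left_diff_distrib scale_hecke_mult_left mult_t
          hecke.span_diff hecke.span_scale)
  }
qed

text \<open>Since y u^n y^(-1) = t^n, membership concerns z^k r t^n, and t^n is a combination of 1
  and t.\<close>

lemma known_basic_coset: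
  assumes "k \<le> 3" "r \<in> set transversal"
  shows "known (basic_coset k r)"
  unfolding known_same_coset[OF basic_coset_val]
proof
  fix n
  have "central_z ^ k * (gens_val r * h) \<in> basis_span" if "h \<in> hecke.span {1, gen_t}" for h
    using that
  proof (induction rule: hecke.span_induct_alt)
    case base
    then show ?case by (simp add: basis_span_def hecke.span_zero)
  next
    case (step c h h')
    then obtain j :: nat where "h = gen_t ^ j" "j \<le> 1"
      by (metis insertE singletonD power_0 power_one_right le_refl zero_le)
    then have "central_z ^ k * (gens_val r * h) \<in> basis_span"
      unfolding basis_span_def using assms by (blast intro: hecke.span_base)
    with step show ?case
      by (simp add: distrib_left scale_hecke_mult_right basis_span_def hecke.span_add hecke.span_scale)
  qed
  from this[OF zpower_t_in_span]
  show "central_z ^ k * (gens_val r * ustu) * zpower gen_u n * unit_inv ustu \<in> basis_span"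
    by (simp add: mult.assoc flip: ustu_zpower_u)
qed

text \<open>A spanning element is b = z^k r t^j = z^k r y u^j y^(-1), so its product with a
  generator is governed by the coset of that generator times z^k r y.\<close>

lemma basis_span_left:
  assumes known: "\<And>k r. k \<le> 3 \<Longrightarrow> r \<in> set transversal \<Longrightarrow> known (mult_gen g (basic_coset k r))"
    and "h \<in> basis_span"
  shows "hecke_gen g * h \<in> basis_span"
  using assms(2) unfolding basis_span_def
proof (induction rule: hecke.span_induct_alt)
  case base
  then show ?case by (simp add: hecke.span_zero)
next
  case (step c b h)
  then obtain k r j where b: "b = central_z ^ k * (gens_val r * gen_t ^ j)"
    and kr: "k \<le> 3" "r \<in> set transversal" by blast
  have "same_coset (hecke_gen g * (central_z ^ k * (gens_val r * ustu)))
      (coset_val (mult_gen g (basic_coset k r)))"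
    by (rule same_coset_trans[OF same_coset_mult[OF basic_coset_val] coset_val_mult_gen])
  \<comment> \<open>The choice n = j recovers the factor t^j of b.\<close>
  then have "hecke_gen g * (central_z ^ k * (gens_val r * ustu)) * zpower gen_u (int j) * unit_inv ustu
      \<in> basis_span"
    using known[OF kr] known_same_coset by blast
  then have "hecke_gen g * b \<in> basis_span"
    using ustu_zpower_u[of "int j"] by (simp add: b zpower_of_nat mult.assoc)
  with step show ?case
    by (simp add: distrib_left scale_hecke_mult_right basis_span_def hecke.span_add hecke.span_scale)
qed

section \<open>The derivation from the 48 starting cosets\<close>

text \<open>Explicit enumeration lets \<open>known_0\<close> turn the starting cosets into rewrite
  rules on normal forms, the base of the tables that follow.\<close>

lemma known_basic_cosets:
  "list_all (\<lambda>r. list_all (\<lambda>k. known (basic_coset k r)) [0, 1, 2, 3]) transversal"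
  by (auto simp: list_all_iff intro: known_basic_coset)

lemmas known_0 [simp] = known_basic_cosets[unfolded transversal_def basic_coset_def, simplified]

text \<open>
  The derivation was found by a computer search. In a step \<open>(p, r, w, ks)\<close> the rule is applied to
  \<open>p\<close>, \<open>r\<close> and \<open>(k, w)\<close> for each \<open>k\<close> in \<open>ks\<close>; each list of
  steps only relies on the previous ones, whose conclusions are simplification rules.
\<close>

lemmas known_1 [simp] = known_steps[of "[
  ([], S', [XX], [0, 1, 2, 3]),
  ([], U', [V 2, X], [0, 1, 2, 3]),
  ([], U', [V 1, XX], [0, 1, 2, 3]),
  ([], S', [X, V 1, X], [0, 1, 2, 3]),
  ([], S', [X, V (- 1), XX], [0, 1, 2, 3]),
  ([], U', [V 1, X, V 1, X], [0, 1, 2, 3]),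
  ([V 1, X, V 1], U', [X], [0, 1, 2, 3]),
  ([], S', [XX, V (- 1), XX, V 1, X], [- 1, 0, 1, 2]),
  ([], U', [V 2, X, V 1, XX, V (- 1), XX], [- 1, 0, 1, 2]),
  ([V 1, X, V 1], S, [XX, V 1, X], [- 1, 0, 1, 2]),
  ([V 1, X, V 1], U', [XX, V (- 1), XX], [- 1, 0, 1, 2]),
  ([V 1, X], U', [V 1, XX, V 1, X], [- 1, 0, 1, 2]),
  ([V 1, X], U', [V 1, XX, V (- 1), XX, V (- 1), XX, V 1, X], [- 2, - 1, 0, 1]),
  ([XX], S, [], [1, 2, 3]),
  ([], U, [V 1, X], [1, 2, 3]),
  ([], S, [V 2, X], [0, 1, 3]),
  ([], S, [V 1, X], [1, 2, 3]),
  ([V 2, X, V 1], S, [], [1, 2, 3]),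
  ([], U, [XX], [2, 3]),
  ([V 1, X, V 1], S, [], [1, 2]),
  ([XX], U', [XX, V 1, X], [- 1, 1]),
  ([V 2, X], U, [XX, V (- 1), XX], [- 1, 2]),
  ([V 1, X, V 1, XX], U, [X], [1, 2]),
  ([V 1, X], U, [XX, V (- 1), XX], [- 1, 2]),
  ([XX], U, [V (- 1), XX, V 1, X], [1, 2]),
  ([V 1, X, V 1, XX, V 1, X], S, [], [1, 2]),
  ([V 2, X], S, [], [1]),
  ([], U, [X, V 1, X], [3]),
  ([XX, V (- 1), XX], U, [X], [1]),
  ([], U, [V 1, X, V 1, XX, V (- 1), XX], [1])]", simplified]

lemmas known_2 [simp] = known_steps[of "[
  ([XX], U, [X, V 1, X], [0, 1, 2]),
  ([V 1, XX], S, [XX], [- 1, 2]),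
  ([XX, V (- 2), XX], U, [X], [1, 2]),
  ([V 1, X], U, [XX, V (- 1), X], [1, 2]),
  ([V 1, X, V 2, X], U, [V 1, X], [0, 1]),
  ([V 1, X, V 1, X], U, [V 1, X], [0, 2]),
  ([V 1, X], U, [V 1, X, V 2, X], [- 1, 2]),
  ([V 1, X], U, [V 1, X, V 1, X], [0, 1]),
  ([], S, [X], [2]),
  ([X], S, [], [3]),
  ([V 2, XX], S, [XX], [- 1]),
  ([V (- 1), X], U, [X], [3]),
  ([X], U, [XX, V (- 1), XX], [1]),
  ([V 2, X, V 1, XX], U', [XX], [0]),
  ([], U, [V 1, X, V 2, X, V 1, X], [0]),
  ([], U, [V 1, X, V 1, X, V 1, X], [0]),
  ([], U, [V 1, X, V (- 1), XX, V (- 1), XX], [2])]", simplified]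

lemmas known_3 [simp] = known_steps[of "[
  ([], S, [V 1, XX, V 1, X], [0, 1, 2]),
  ([XX], S, [XX], [1, 2]),
  ([V 1, XX, V 1], U, [X], [- 1, 2]),
  ([V 1, X, V 1], U, [XX], [0, 1]),
  ([V 1], S', [X, V 1, XX], [1]),
  ([V 1, XX, V 1, X], S, [], [2]),
  ([], U, [X, V (- 1), XX, V (- 1), XX], [2]),
  ([X], U, [V 1, X, V 1, X], [0])]", simplified]

lemmas known_4 [simp] = known_steps[of "[
  ([], S', [], [1, 2, 3]),
  ([XX], U, [X], [0, 1, 2]),
  ([], S', [XX, V 1, X], [0, 1, 2]),
  ([V 1, X], U, [XX], [0, 1, 2]),
  ([XX, V (- 1), XX], U', [X, V 1, X], [- 1, 0, 1]),
  ([V 1], S', [], [1, 2]),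
  ([X], U', [XX], [1, 2]),
  ([V 1, XX], S, [X], [1, 2]),
  ([V 1, X, V 1, X], U, [XX, V 1, X], [- 1, 1]),
  ([V (- 1)], S', [], [3]),
  ([], U, [XX, V 1, X], [0]),
  ([XX], S, [V 1, X], [2]),
  ([V 2, XX, V 1], U', [X], [- 1]),
  ([XX, V 1, XX], S', [XX], [- 1]),
  ([X], U, [X, V 1, X], [2]),
  ([V (- 1), X, V (- 1), XX], U, [V (- 1), XX], [2]),
  ([V 1, XX, V (- 1), XX], U', [X, V 1, XX], [0]),
  ([V 1, X, V 1, X, V 1, XX], U, [X], [0])]", simplified]

lemmas known_5 [simp] = known_steps[of "[
  ([XX, V (- 1), XX], U', [XX, V 1, X], [- 1, 0, 1]),
  ([], S, [V 1, XX], [1, 2]),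
  ([XX, V (- 1), XX], S', [], [0, 1]),
  ([], U', [V 1, X, V 1, XX], [1, 2]),
  ([XX, V (- 2)], S, [V 1, XX], [1, 2]),
  ([V 1, XX, V 1, X], U, [XX], [0, 1]),
  ([XX, V (- 1), X], U', [V 1, X], [0, 2]),
  ([XX], U', [XX], [1]),
  ([V 1, XX], U', [XX], [0]),
  ([], U', [V 1, X, V (- 1), XX], [0]),
  ([V 1], S', [X, V (- 1), XX], [0]),
  ([V (- 1), XX], S, [V (- 1), XX], [2]),
  ([XX], S, [V 1, XX, V 1, X], [1]),
  ([XX], U', [XX, V 1, X, V 1, X], [1]),
  ([XX, V 1, X], U', [XX, V (- 1), XX], [- 1]),
  ([V 1, X, V 1, X, V (- 1), XX], U, [X], [1]),
  ([V 1, X, V 1, X], U, [XX, V (- 1), X], [0]),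
  ([XX, V 1, X], U', [V 1, X, V 1, X], [1]),
  ([V 1, X, V 1, XX], U', [XX, V (- 1), XX, V 1, X], [- 2])]", simplified]

lemmas known_6 [simp] = known_steps[of "[
  ([V 1], S', [X], [2, 3]),
  ([V 2, X, V 1], U', [XX], [1, 2]),
  ([XX], U', [X, V 2, X], [0, 2]),
  ([V 1, XX], U, [X, V (- 1), XX], [0, 1]),
  ([V 1, X, V 1, XX], S, [X], [0, 1]),
  ([V 1, X, V 1, X], U, [XX], [0, 1]),
  ([XX, V (- 1), XX, V 1, XX], S', [XX], [- 1, 0]),
  ([XX, V (- 1), X, V 1, X], U, [XX], [0, 1]),
  ([V 2, X], U', [XX], [0]),
  ([XX], U', [X, V (- 1), XX], [1]),
  ([XX, V 1, X], U', [V 1, X], [1]),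
  ([V 1, X], U', [V 1, X, V 1, XX], [0]),
  ([XX, V 1, X, V 1, XX], U', [XX], [- 1]),
  ([V 1, XX, V (- 1), XX, V (- 1), X], U', [XX], [- 1]),
  ([V 1, XX], U', [XX, V 1, X, V 1, XX], [0]),
  ([V (- 1), XX], U, [X, V 1, X, V (- 1), XX], [1]),
  ([XX], U, [X, V 1, X, V 1, XX, V 1, X], [0])]", simplified]

lemmas known_7 [simp] = known_steps[of "[
  ([XX], S', [XX, V 1, X], [0, 1, 2]),
  ([V 1, XX, V (- 1), XX], S, [], [0, 1]),
  ([V 1, X, V 1, XX], S, [], [0, 1]),
  ([V 1, XX, V (- 1), XX], U', [X], [1, 2]),
  ([V 2, X, V 2, X], U', [V 1, X], [1, 2]),
  ([XX, V (- 1), X], U, [X, V (- 1), XX], [0, 1]),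
  ([V 1, X, V 1, XX], U, [X, V 1, XX], [- 1, 0]),
  ([XX, V (- 1), XX, V 1, X], U', [XX, V (- 1), XX], [- 1, 0]),
  ([V 2, X, V 1], U', [XX], [0]),
  ([V 1, X, V 1], S', [X], [1]),
  ([XX], S', [X, V 1, XX], [0]),
  ([XX, V 1, X], U', [XX], [1]),
  ([V 1, XX, V 1, XX], S', [X], [1]),
  ([], U', [V 1, XX, V (- 1), X, V (- 1), XX], [0]),
  ([V 2, X, V 1, X], U', [V 1, X], [0]),
  ([V 1, X], U', [V 1, X, V (- 1), XX], [1]),
  ([X], S, [X, V 1, X, V (- 1), XX], [1]),
  ([V 1, XX, V (- 1), XX], U', [X, V 1, XX], [- 1]),
  ([XX, V (- 1), X, V 1, X, V 1, XX], U, [X], [0])]", simplified]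

lemmas known_8 [simp] = known_steps[of "[
  ([], S, [V 1, XX, V (- 1), X, V (- 1), XX], [0, 1]),
  ([V 1, XX, V (- 1), XX], U, [X, V 1, X], [- 1, 0]),
  ([V 1, X, V 1, XX, V (- 1), X], U, [XX], [- 1, 0]),
  ([V 1, X, V 1, XX], U, [X, V 1, X], [- 1, 0]),
  ([XX], S', [X], [2]),
  ([V 1], S', [V 2, X], [1]),
  ([V 2, XX], U', [X, V (- 1), XX], [0]),
  ([V 1, XX], U', [XX, V 1, X], [1]),
  ([V 1, X, V 2, X], U', [XX], [1]),
  ([V 2, X, V 2, X], U', [V 1, X], [0]),
  ([X, V (- 1), XX], U', [X, V 1, XX], [0]),
  ([V 1, XX, V 1, X], U', [XX, V (- 1), X], [1]),
  ([V 1, XX], U', [XX, V 1, X, V 1, XX], [- 1]),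
  ([V 1, X, V 1, XX, V (- 1), XX], U', [X], [0]),
  ([XX, V (- 1), X, V 1, X], U, [XX, V (- 1), X], [0]),
  ([X, V 1, X, V 1, XX], U, [X, V (- 1), XX], [0]),
  ([V 1, X, V 1, XX, V 1, XX], U', [XX, V 1, X], [- 2])]", simplified]

lemmas known_9 [simp] = known_steps[of "[
  ([V 1], S, [X, V 1, X], [0, 1]),
  ([V 1, X, V 1, X], U, [XX, V (- 1), X, V (- 1), XX], [- 1, 0]),
  ([V 1, X, V 1], S', [X], [2]),
  ([X, V (- 1), XX], S', [X], [1]),
  ([V 2, XX, V 1, X], U', [XX], [0]),
  ([V 1, XX, V 1, XX], S', [X], [0]),
  ([V 1, XX], U', [XX, V 1, X], [0]),
  ([V 1, XX], S', [X, V (- 1), X], [2]),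
  ([], U', [V 1, X, V (- 1), XX, V (- 1), X], [2]),
  ([XX, V (- 1), X, V 1, XX], S, [X], [0]),
  ([V 1, X, V 1, XX], U', [XX, V 1, X], [0]),
  ([V 1, X], U, [XX, V (- 1), X, V (- 1), XX], [0]),
  ([V 1, XX, V 1, X], U', [V 1, X, V 1, X], [1]),
  ([X, V 1, X], U, [XX, V (- 1), X, V (- 1), XX], [0])]", simplified]

lemmas known_10 [simp] = known_steps[of "[
  ([V 1, X, V 1, XX], S, [X, V (- 1), XX], [- 1, 0]),
  ([V 2, XX], S', [X], [1]),
  ([V 2, X], U, [XX, V 1, X], [- 1]),
  ([V 2, X], U', [XX, V (- 1), X], [2]),
  ([V 1, XX, V 1, XX], S', [XX], [0]),
  ([V 1, XX], S, [X, V (- 1), XX], [0]),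
  ([], U, [V 1, X, V 1, XX, V 1, X], [0]),
  ([V 2, X, V 1], S', [XX, V 1, X], [0]),
  ([X], U', [X, V (- 1), XX, V (- 1), X], [1]),
  ([X, V 1, XX], S, [X, V (- 1), XX], [0]),
  ([V 1, XX, V 1, X], U', [XX, V (- 1), X], [0]),
  ([V 1, XX], S', [XX, V 1, X, V 1, X], [1]),
  ([V 1, X, V 1, XX, V (- 1), XX], U', [X], [1]),
  ([V 1, X, V (- 1), XX, V (- 1), X], U', [X], [2]),
  ([XX, V (- 1), X], U, [XX, V 1, X, V 1, XX], [- 1]),
  ([V 1, X, V 1, XX, V 1, X], U', [V 1, X, V 1, X], [0])]", simplified]

lemmas known_11 [simp] = known_steps[of "[
  ([V 2, X, V 1, XX], U', [X], [2]),
  ([V 2, X], U', [XX, V (- 1), X], [1]),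
  ([V 2, X, V (- 1)], S', [XX, V 1, X], [- 1]),
  ([X, V 1, X], U', [XX, V (- 1), X], [1]),
  ([V 1, XX, V 1, X, V 1, XX], U', [X], [0]),
  ([V 1, XX, V 1, X], U, [XX, V (- 1), XX], [- 1]),
  ([V 1, XX, V 1, X], U', [XX, V (- 1), XX], [0]),
  ([V 1, X, V 1, XX, V 1, X, V 1], S', [], [1]),
  ([V 1, X, V 1, XX], U', [XX, V 1, X], [1]),
  ([V 1, X], U', [XX, V (- 1), X, V 1, X], [2]),
  ([XX, V (- 1), X, V (- 1), XX], U, [X, V 1, XX], [- 1]),
  ([X, V 1, XX, V 1, X], U, [XX, V (- 1), XX], [- 1]),
  ([V 1, X], U', [XX, V (- 1), XX, V 1, X, V 1, X], [1])]", simplified]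

lemmas known_12 [simp] = known_steps[of "[
  ([X], S', [X, V (- 1), X], [2]),
  ([V 2, X, V 1, XX], U', [X], [1]),
  ([V 1, XX, V 1, XX], S, [XX], [- 1]),
  ([V 1, XX], S', [X, V 1, X], [1]),
  ([V 1, XX], S', [X, V (- 1), XX], [1]),
  ([V 2, X, V 1], S', [XX, V 1, X], [2]),
  ([V 1, X, V 1, XX, V (- 1), XX], S', [], [2]),
  ([XX, V (- 1), XX], S, [X, V 1, XX], [- 1]),
  ([X, V 1, XX, V 1, XX], S, [XX], [- 1]),
  ([V 1, X, V 1, XX, V 1, X], U', [V 1, X, V 1, X], [1])]", simplified]

lemmas known_13 [simp] = known_steps[of "[
  ([V 1, XX], U, [XX, V 1, X], [- 1]),
  ([V (- 1), XX, V (- 1), X], U', [X], [2]),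
  ([V 2, X, V 1], S', [XX, V 1, X], [1]),
  ([X, V 1, XX], U, [XX, V 1, X], [- 1]),
  ([], S', [X, V 1, XX, V 1, XX, V 1, X], [- 1]),
  ([V 1, X, V 1, XX, V 1, X, V 1], S', [], [2]),
  ([V 1, X], U', [XX, V (- 1), X, V 1, X], [1]),
  ([V 1, X], U', [XX, V (- 1), X, V (- 1), XX], [1]),
  ([XX, V (- 1), XX, V 1, X, V 1, XX], U, [XX], [- 2])]", simplified]

lemmas known_14 [simp] = known_steps[of "[
  ([], U', [XX, V (- 1), X, V 1, X], [2]),
  ([X], U, [XX, V (- 1), XX, V 1, X], [- 1]),
  ([V 1, X, V 1, XX], U', [X, V 1, X], [1]),
  ([V 2, X], U', [XX, V (- 1), XX, V (- 1), XX, V 1, X], [- 2]),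
  ([XX, V (- 1), XX], U', [X, V 1, XX, V 1, XX, V 1, X], [- 2])]", simplified]

lemmas known_15 [simp] = known_steps[of "[
  ([], S', [X, V 1, X, V 1, X], [2]),
  ([V 1, XX], U', [X, V 1, X], [2]),
  ([XX, V (- 1), XX], S', [X, V 1, XX, V 1, X], [- 1])]", simplified]

lemmas known_16 [simp] = known_steps[of "[
  ([V 1, XX], S', [], [3]),
  ([XX, V (- 1), XX], U', [X, V 1, X, V 1, X], [1]),
  ([XX, V (- 1), X, V (- 1), XX], U', [X, V 1, XX, V 1, X], [- 1])]", simplified]

lemmas known_17 [simp] = known_steps[of "[
  ([XX, V (- 1), XX, V 1, X], S', [], [2]),
  ([XX, V (- 1), XX, V 1, X], U', [V 1, X, V 1, X], [1]),
  ([XX, V (- 1), X], U', [XX, V 1, X, V 1, XX, V 1, X], [- 1])]", simplified]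

lemmas known_18 [simp] = known_steps[of "[
  ([XX, V (- 1), XX, V 1, X, V 1], S', [], [2]),
  ([XX], U', [X, V 1, XX, V 1, X, V 1, XX, V 1, X], [- 1])]", simplified]

lemmas known_19 [simp] = known_steps[of "[
  ([XX, V 1, X, V 1, XX], S', [X, V 1, X], [0])]", simplified]

lemmas known_20 [simp] = known_steps[of "[
  ([XX, V 1, X, V 1, X, V (- 1), XX], U', [X, V 1, X], [0])]", simplified]

lemmas known_21 [simp] = known_steps[of "[
  ([XX, V 1, X, V 1, X], U', [XX, V 1, X, V 1, X], [0])]", simplified]

lemmas known_22 [simp] = known_steps[of "[
  ([XX], S', [V 1, XX, V 1, X, V 1, X], [1])]", simplified]

lemmas known_23 [simp] = known_steps[of "[
  ([X], U', [X, V 1, X, V 1, X], [2])]", simplified]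

lemmas known_24 [simp] = known_steps[of "[
  ([X], S', [V 1, X], [3])]", simplified]

text \<open>Evaluation brings each of the 144 products of a generator and a starting coset to a
  normal form covered by the facts \<open>known_0\<close> to \<open>known_24\<close>.\<close>

lemma known_mult_gen:
  assumes "k \<le> 3" "r \<in> set transversal"
  shows "known (mult_gen g (basic_coset k r))"
proof -
  have "k \<in> {0, 1, 2, 3}"
    using assms(1) by auto
  with assms(2) show ?thesis
    by (cases g) (auto simp: transversal_def basic_coset_def)
qed

section \<open>Generation of the algebra by left multiplication\<close>

lemma hecke_gen_abs: "hecke_gen g = abs_hecke (var g)"
  by (cases g) (simp_all add: gen_s_def gen_t_def gen_u_def)

text \<open>Every element is the class of a noncommutative polynomial. Its words arise from scalars
  by adding letters on the left, and the polynomial is a finite sum of scaled words.\<close>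

lemma hecke_left_generated:
  assumes "hecke.subspace A" "1 \<in> A" and left: "\<And>g h. h \<in> A \<Longrightarrow> hecke_gen g * h \<in> A"
  shows "h \<in> A"
proof -
  have single: "abs_hecke (Poly_Mapping.single (Word l) c) \<in> A" for l c
  proof (induction l)
    case Nil
    have "abs_hecke (Poly_Mapping.single (Word []) c) = scale_hecke c 1"
      by (simp add: one_hecke_def scale_hecke.abs_eq const_def zero_word_def)
    then show ?case
      using assms by (simp add: hecke.subspace_scale)
  next
    case (Cons g l)
    have "Poly_Mapping.single (Word (g # l)) c = var g * Poly_Mapping.single (Word l) c"
      by (simp add: var_def mult_single plus_word_def)
    then have "abs_hecke (Poly_Mapping.single (Word (g # l)) c)
        = hecke_gen g * abs_hecke (Poly_Mapping.single (Word l) c)"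
      by (simp add: hecke_gen_abs times_hecke.abs_eq)
    then show ?case
      using left[OF Cons] by simp
  qed
  have sum: "abs_hecke (\<Sum>k\<in>K. Poly_Mapping.single k (f k)) \<in> A" if "finite K" for K f
    using that
  proof (induction K)
    case empty
    have "abs_hecke 0 = 0" by (simp add: zero_hecke_def)
    then show ?case using assms(1) by (simp add: hecke.subspace_0)
  next
    case (insert k K)
    then show ?case
      using single[of "letters k" "f k"] assms(1)
      by (simp add: hecke.subspace_add flip: plus_hecke.abs_eq)
  qed
  have "abs_hecke p \<in> A" for p
    by (subst poly_mapping_eq_sum) (simp add: sum)
  then show ?thesis
    by (metis Quotient_abs_rep Quotient_hecke)
qed

lemma basis_span_UNIV: "basis_span = UNIV"
proof -
  have "1 \<in> basis_span"
  proof -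
    have "1 = central_z ^ 0 * (gens_val [] * gen_t ^ 0)"
      by (simp add: gens_val_def)
    moreover have "[] \<in> set transversal"
      by (simp add: transversal_def)
    ultimately show ?thesis
      unfolding basis_span_def by (blast intro: hecke.span_base)
  qed
  moreover have "hecke_gen g * h \<in> basis_span" if "h \<in> basis_span" for g h
    using known_mult_gen that by (rule basis_span_left)
  moreover have "hecke.subspace basis_span"
    by (simp add: basis_span_def hecke.subspace_span)
  ultimately show ?thesis
    using hecke_left_generated by blast
qed

section \<open>Comparison with U\<close>

lemma set_prodI: "a \<in> A \<Longrightarrow> b \<in> B \<Longrightarrow> a * b \<in> A \<star> B"
  unfolding set_prod_def by (blast intro: hecke.span_base)

lemma subspace_set_prod: "hecke.subspace (A \<star> B)"
  by (simp add: set_prod_def hecke.subspace_span)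

lemma subspace_set_plus:
  assumes "hecke.subspace A" "hecke.subspace B"
  shows "hecke.subspace (A + B)"
proof (rule hecke.subspaceI)
  show "0 \<in> A + B"
    using assms[THEN hecke.subspace_0] by (metis add_0 set_plus_intro)
next
  fix a b assume "a \<in> A + B" "b \<in> A + B"
  then obtain a1 a2 b1 b2 where "a = a1 + a2" "b = b1 + b2" "a1 \<in> A" "b1 \<in> A" "a2 \<in> B" "b2 \<in> B"
    by (auto elim!: set_plus_elim)
  then have "a + b = (a1 + b1) + (a2 + b2)" "a1 + b1 \<in> A" "a2 + b2 \<in> B"
    using assms by (auto simp: algebra_simps intro: hecke.subspace_add)
  then show "a + b \<in> A + B" by (metis set_plus_intro)
next
  fix c a assume "a \<in> A + B"
  then show "scale_hecke c a \<in> A + B"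
    using assms by (auto elim!: set_plus_elim simp: hecke.scale_right_distrib
        intro!: set_plus_intro intro: hecke.subspace_scale)
qed

lemma subspace_elt_set_times:
  assumes "hecke.subspace A"
  shows "hecke.subspace (a *o A)"
  using assms unfolding hecke.subspace_def elt_set_times_def
  by (auto simp flip: distrib_left scale_hecke_mult_right) (metis mult_zero_right)

lemma subspace_set_sum: "(\<And>i. i \<in> I \<Longrightarrow> hecke.subspace (f i)) \<Longrightarrow> hecke.subspace (\<Sum>i\<in>I. f i)"
  by (induction I rule: infinite_finite_induct) (simp_all add: subspace_set_plus set_zero)

lemma mem_set_plus_left: "hecke.subspace B \<Longrightarrow> a \<in> A \<Longrightarrow> a \<in> A + B"
  by (metis add.right_neutral hecke.subspace_0 set_plus_intro)

lemma mem_set_plus_right: "hecke.subspace A \<Longrightarrow> b \<in> B \<Longrightarrow> b \<in> A + B"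
  by (metis add.commute mem_set_plus_left)

lemma mem_set_sum:
  assumes "finite I" "i \<in> I" "a \<in> f i" "\<And>i. i \<in> I \<Longrightarrow> hecke.subspace (f i)"
  shows "a \<in> (\<Sum>i\<in>I. f i)"
proof -
  have "(\<Sum>i\<in>I. f i) = f i + (\<Sum>i\<in>I - {i}. f i)"
    using assms by (simp add: sum.remove)
  moreover have "hecke.subspace (\<Sum>i\<in>I - {i}. f i)"
    using assms(4) by (intro subspace_set_sum) simp
  ultimately show ?thesis
    using assms(3) by (simp add: mem_set_plus_left)
qed

lemma one_gen_mem [simp]:
  "1 \<in> u1" "1 \<in> u2" "1 \<in> u3" "gen_s \<in> u1" "gen_t \<in> u2" "gen_u \<in> u3"
  using subalgebra_generated
  by (simp_all add: u1_def u2_def u3_def subalgebra_def generated_subalgebra_def hull_inc)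

lemma prod4_mem:
  "a \<in> A \<Longrightarrow> b \<in> B \<Longrightarrow> c \<in> C \<Longrightarrow> d \<in> D \<Longrightarrow> a * b * c * d \<in> A \<star> B \<star> C \<star> D"
  by (intro set_prodI)

theorem theorem4p3p35:
  shows "(UNIV :: hecke set) = U_G13"
proof -
  let ?V = "u1 \<star> u2 \<star> u1 \<star> u2 + u1 \<star> u2 \<star> u3 \<star> u2 + u2 \<star> u3 \<star> u1 \<star> u2
    + u2 \<star> u1 \<star> u3 \<star> u2 + u3 \<star> u2 \<star> u1 \<star> u2"
  have V: "hecke.subspace ?V"
    by (intro subspace_set_plus subspace_set_prod)
  have V_I: "a \<in> ?V" if "a \<in> u1 \<star> u2 \<star> u1 \<star> u2 \<or> a \<in> u1 \<star> u2 \<star> u3 \<star> u2 \<or> a \<in> u2 \<star> u3 \<star> u1 \<star> u2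
      \<or> a \<in> u2 \<star> u1 \<star> u3 \<star> u2 \<or> a \<in> u3 \<star> u2 \<star> u1 \<star> u2" for a
    using that
    by (elim disjE) (blast intro: mem_set_plus_left mem_set_plus_right subspace_set_plus subspace_set_prod)+
  have gens: "gens_val r * d \<in> ?V" if "r \<in> set transversal" "d \<in> u2" for r d
  proof -
    \<comment> \<open>The fourth factor is always \<open>d\<close>. Below there is one instance for
      each word, in the order of \<open>transversal\<close>, with 1 in the places a word leaves
      empty.\<close>
    note p = prod4_mem[OF _ _ _ that(2)]
    have "gens_val r * d \<in> u1 \<star> u2 \<star> u1 \<star> u2 \<or> gens_val r * d \<in> u1 \<star> u2 \<star> u3 \<star> u2
      \<or> gens_val r * d \<in> u2 \<star> u3 \<star> u1 \<star> u2 \<or> gens_val r * d \<in> u2 \<star> u1 \<star> u3 \<star> u2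
      \<or> gens_val r * d \<in> u3 \<star> u2 \<star> u1 \<star> u2"
      using that(1) p[of 1 u1 1 u2 1 u1] p[of gen_s u1 1 u2 1 u1] p[of 1 u1 gen_t u2 gen_s u1]
        p[of gen_s u1 gen_t u2 gen_s u1] p[of 1 u1 1 u2 gen_u u3] p[of gen_s u1 1 u2 gen_u u3]
        p[of 1 u1 gen_t u2 gen_u u3] p[of gen_s u1 gen_t u2 gen_u u3] p[of 1 u2 gen_u u3 gen_s u1]
        p[of gen_t u2 gen_u u3 gen_s u1] p[of gen_t u2 gen_s u1 gen_u u3] p[of gen_u u3 gen_t u2 gen_s u1]
      by (auto simp: transversal_def gens_val_def mult.assoc)
    then show ?thesis by (rule V_I)
  qed
  have pow: "gen_t ^ j \<in> u2" if "j \<le> 1" for j :: nat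
    using that by (cases j) auto
  have zV: "hecke.subspace (central_z ^ k *o ?V)" for k
    using V by (rule subspace_elt_set_times)
  have "central_z ^ k * (gens_val r * gen_t ^ j) \<in> U_G13"
    if "k \<le> 3" "r \<in> set transversal" "j \<le> 1" for k r j
  proof -
    have "central_z ^ k * (gens_val r * gen_t ^ j) \<in> central_z ^ k *o ?V"
      using gens[OF that(2) pow[OF that(3)]] by (rule set_times_intro2)
    then show ?thesis
      unfolding U_G13_def using that(1) zV by (intro mem_set_sum[of _ k]) auto
  qed
  moreover have "hecke.subspace U_G13"
    unfolding U_G13_def by (rule subspace_set_sum) (rule zV)
  \<comment> \<open>As U is a submodule, it suffices that it contains the spanning elements; their
    span is already the whole algebra.\<close>
  ultimately have "basis_span \<subseteq> U_G13"
    unfolding basis_span_def by (intro hecke.span_minimal) blast+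
  then show ?thesis
    by (simp add: basis_span_UNIV set_eq_subset)
qed

end
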